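(* Let $\mathcal{U}$ be a universe, $P$ a set of parameters, $X\subseteq P$ nonempty, and let $\varphi_X$ be a $\Phi$-soft set on $\mathcal{U}$ with parameter set $X$. Let $\varphi_{\emptyset}$ and $\varphi_{\hat X}$ be, respectively, the relative null and the relative whole $\Phi$-soft set with respect to $X$. Then: (i) $\varphi_X\,\hat\cup_E\,\varphi_X=\varphi_X\,\hat\cup_R\,\varphi_X=\varphi_X$; (ii) $\varphi_X\,\hat\cap_E\,\varphi_X=\varphi_X\,\hat\cap_R\,\varphi_X=\varphi_X$; (iii) $\varphi_X\,\hat\cup_E\,\varphi_\emptyset=\varphi_X\,\hat\cup_R\,\varphi_\emptyset=\varphi_X$; (iv) $\varphi_X\,\hat\cap_E\,\varphi_\emptyset=\varphi_X\,\hat\cap_R\,\varphi_\emptyset=\varphi_\emptyset$; (v) $\varphi_X\,\hat\cup_E\,\varphi_{\hat X}=\varphi_X\,\hat\cup_R\,\varphi_{\hat X}=\varphi_{\hat X}$; (vi) $\varphi_X\,\hat\cap_E\,\varphi_{\hat X}=\varphi_X\,\hat\cap_R\,\varphi_{\hat X}=\varphi_X$.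
   Context: Let $\mathcal{L}=\{(u,v)\in[0,1]^2: u^2+v^2\le 1\}$ (Pythagorean fuzzy values). A Pythagorean fuzzy set on $\mathcal{U}$ is a map $\mathcal{U}\to\mathcal{L}$, $a\mapsto (m(a),n(a))$. A $\Phi$-soft set (Pythagorean fuzzy parameterized soft set) $\varphi_X$ on $\mathcal{U}$ with parameter set $X\subseteq P$ consists of $X$, a map $\varphi(X)$ assigning to each $x\in X$ a Pythagorean fuzzy set $\varphi(X)(x)$ on $\mathcal{U}$, and a map $f_X:X\to\mathcal{L}$, $f_X(x)=(m_{f_X}(x),n_{f_X}(x))$. Two $\Phi$-soft sets $\varphi_X,\varphi_Y$ are equal if $X=Y$, $\varphi(X)=\varphi(Y)$ and $f_X=f_Y$. For $(m_1,n_1),(m_2,n_2)\in\mathcal{L}$ put $(m_1,n_1)\vee(m_2,n_2)=(\max\{m_1,m_2\},\min\{n_1,n_2\})$ and $(m_1,n_1)\wedge(m_2,n_2)=(\min\{m_1,m_2\},\max\{n_1,n_2\})$. Extended union $\varphi_X\,\hat\cup_E\,\varphi_Y$: the $\Phi$-soft set $\varphi_Z$ with parameter set $Z=X\cup Y$ such that, for $z\in Z$ and $a\in\mathcal{U}$: if $z\in X\setminus Y$, then $\varphi(Z)(z)=\varphi(X)(z)$ and $f_Z(z)=f_X(z)$; if $z\in Y\setminus X$, then $\varphi(Z)(z)=\varphi(Y)(z)$ and $f_Z(z)=f_Y(z)$; if $z\in X\cap Y$, then $\varphi(Z)(z)(a)=\varphi(X)(z)(a)\vee\varphi(Y)(z)(a)$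 and $f_Z(z)=f_X(z)\vee f_Y(z)$. The extended intersection $\hat\cap_E$ is defined in the same way (also with parameter set $X\cup Y$) with $\wedge$ in place of $\vee$. Restricted union $\varphi_X\,\hat\cup_R\,\varphi_Y$, defined when $X\cap Y\neq\emptyset$: the $\Phi$-soft set with parameter set $X\cap Y$ whose values at $z\in X\cap Y$ are $a\mapsto\varphi(X)(z)(a)\vee\varphi(Y)(z)(a)$ and $f_X(z)\vee f_Y(z)$. The restricted intersection $\hat\cap_R$ is defined in the same way with $\wedge$ in place of $\vee$. The relative null $\Phi$-soft set $\varphi_\emptyset$ with respect to $X$ has parameter set $X$, with $\varphi(X)(x)(a)=(0,1)$ for all $x\in X$, $a\in\mathcal{U}$, and $f_X(x)=(0,1)$ for all $x\in X$. The relative whole $\Phi$-soft set $\varphi_{\hat X}$ with respect to $X$ has parameter set $X$, with $\varphi(X)(x)(a)=(1,0)$ for all $x\in X$, $a\in\mathcal{U}$, and $f_X(x)=(1,0)$ for all $x\in X$. *)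

theory Defs
  imports Complex_Main "HOL-Library.FuncSet"
begin

type_synonym pfv = "real \<times> real"

definition PFV :: "pfv set" where
  "PFV = {(u, v). u \<in> {0..1} \<and> v \<in> {0..1} \<and> u\<^sup>2 + v\<^sup>2 \<le> 1}"

fun pfv_join :: "pfv \<Rightarrow> pfv \<Rightarrow> pfv" where
  "pfv_join (m1, n1) (m2, n2) = (max m1 m2, min n1 n2)"

fun pfv_meet :: "pfv \<Rightarrow> pfv \<Rightarrow> pfv" where
  "pfv_meet (m1, n1) (m2, n2) = (min m1 m2, max n1 n2)"

text \<open>
  Maps with a prescribed domain are rendered as extensional functions, that is, functions that
  take the value \<^term>\<open>undefined\<close> outside their domain. Hence equality of \<open>\<Phi>\<close>-soft sets as records
  is exactly equality of the parameter sets and of the two maps on their domains.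
\<close>

definition pythagorean_fuzzy_sets :: "'u set \<Rightarrow> ('u \<Rightarrow> pfv) set" where
  "pythagorean_fuzzy_sets U = U \<rightarrow>\<^sub>E PFV"

text \<open>For \<open>\<phi>\<^sub>X\<close>: \<open>params\<close> is \<open>X\<close>, \<open>approx\<close> is \<open>\<phi>(X)\<close> and \<open>grade\<close> is \<open>f\<^sub>X\<close>.\<close>

record ('p, 'u) phi_soft =
  params :: "'p set"
  approx :: "'p \<Rightarrow> 'u \<Rightarrow> pfv"
  grade :: "'p \<Rightarrow> pfv"

definition phi_soft_set :: "'u set \<Rightarrow> 'p set \<Rightarrow> ('p, 'u) phi_soft \<Rightarrow> bool" where
  "phi_soft_set U P F \<longleftrightarrow>
     params F \<subseteq> P \<and>
     approx F \<in> params F \<rightarrow>\<^sub>E pythagorean_fuzzy_sets U \<and>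
     grade F \<in> params F \<rightarrow>\<^sub>E PFV"

definition extended_op ::
  "(pfv \<Rightarrow> pfv \<Rightarrow> pfv) \<Rightarrow> 'u set \<Rightarrow> ('p, 'u) phi_soft \<Rightarrow> ('p, 'u) phi_soft \<Rightarrow> ('p, 'u) phi_soft" where
  "extended_op f U F G = \<lparr>
     params = params F \<union> params G,
     approx = (\<lambda>z \<in> params F \<union> params G. \<lambda>a \<in> U.
        if z \<in> params F - params G then approx F z a
        else if z \<in> params G - params F then approx G z a
        else f (approx F z a) (approx G z a)),
     grade = (\<lambda>z \<in> params F \<union> params G.
        if z \<in> params F - params G then grade F z
        else if z \<in> params G - params F then grade G z
        else f (grade F z) (grade G z))\<rparr>"

text \<open>
  The restricted operations are defined only for parameter sets that meet; otherwise nothing is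
  specified about the result.
\<close>

definition restricted_op ::
  "(pfv \<Rightarrow> pfv \<Rightarrow> pfv) \<Rightarrow> 'u set \<Rightarrow> ('p, 'u) phi_soft \<Rightarrow> ('p, 'u) phi_soft \<Rightarrow> ('p, 'u) phi_soft" where
  "restricted_op f U F G = (if params F \<inter> params G \<noteq> {} then \<lparr>
     params = params F \<inter> params G,
     approx = (\<lambda>z \<in> params F \<inter> params G. \<lambda>a \<in> U. f (approx F z a) (approx G z a)),
     grade = (\<lambda>z \<in> params F \<inter> params G. f (grade F z) (grade G z))\<rparr>
   else undefined)"

definition extended_union ::
  "'u set \<Rightarrow> ('p, 'u) phi_soft \<Rightarrow> ('p, 'u) phi_soft \<Rightarrow> ('p, 'u) phi_soft" where
  "extended_union = extended_op pfv_join"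

definition extended_inter ::
  "'u set \<Rightarrow> ('p, 'u) phi_soft \<Rightarrow> ('p, 'u) phi_soft \<Rightarrow> ('p, 'u) phi_soft" where
  "extended_inter = extended_op pfv_meet"

definition restricted_union ::
  "'u set \<Rightarrow> ('p, 'u) phi_soft \<Rightarrow> ('p, 'u) phi_soft \<Rightarrow> ('p, 'u) phi_soft" where
  "restricted_union = restricted_op pfv_join"

definition restricted_inter ::
  "'u set \<Rightarrow> ('p, 'u) phi_soft \<Rightarrow> ('p, 'u) phi_soft \<Rightarrow> ('p, 'u) phi_soft" where
  "restricted_inter = restricted_op pfv_meet"

definition relative_null :: "'u set \<Rightarrow> 'p set \<Rightarrow> ('p, 'u) phi_soft" where
  "relative_null U X = \<lparr>
     params = X,
     approx = (\<lambda>x \<in> X. \<lambda>a \<in> U. (0, 1)),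
     grade = (\<lambda>x \<in> X. (0, 1))\<rparr>"

definition relative_whole :: "'u set \<Rightarrow> 'p set \<Rightarrow> ('p, 'u) phi_soft" where
  "relative_whole U X = \<lparr>
     params = X,
     approx = (\<lambda>x \<in> X. \<lambda>a \<in> U. (1, 0)),
     grade = (\<lambda>x \<in> X. (1, 0))\<rparr>"

lemma PFV_iff: "(u, v) \<in> PFV \<longleftrightarrow> 0 \<le> u \<and> u \<le> 1 \<and> 0 \<le> v \<and> v \<le> 1 \<and> u\<^sup>2 + v\<^sup>2 \<le> 1"
  by (auto simp: PFV_def)

lemma PFV_mono:
  assumes "(u, v) \<in> PFV" "0 \<le> u'" "u' \<le> u" "0 \<le> v'" "v' \<le> v"
  shows "(u', v') \<in> PFV"
proof -
  have "u'\<^sup>2 \<le> u\<^sup>2" "v'\<^sup>2 \<le> v\<^sup>2"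
    using assms by (auto intro!: power_mono)
  with assms show ?thesis unfolding PFV_iff by linarith
qed

lemma pfv_join_closed: "pfv_join \<in> PFV \<rightarrow> PFV \<rightarrow> PFV"
proof (intro Pi_I)
  fix p q assume "p \<in> PFV" "q \<in> PFV"
  moreover obtain a b c d where "p = (a, b)" "q = (c, d)" by (cases p, cases q)
  ultimately show "pfv_join p q \<in> PFV"
    using PFV_mono[of a b a "min b d"] PFV_mono[of c d c "min b d"]
    by (cases "a \<le> c") (simp_all add: PFV_iff max_def)
qed

lemma pfv_meet_closed: "pfv_meet \<in> PFV \<rightarrow> PFV \<rightarrow> PFV"
proof (intro Pi_I)
  fix p q assume "p \<in> PFV" "q \<in> PFV"
  moreover obtain a b c d where "p = (a, b)" "q = (c, d)" by (cases p, cases q)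
  ultimately show "pfv_meet p q \<in> PFV"
    using PFV_mono[of a b "min a c" b] PFV_mono[of c d "min a c" d]
    by (cases "b \<le> d") (simp_all add: PFV_iff max_def)
qed

lemma extended_op_phi_soft_set:
  assumes "phi_soft_set U P F" "phi_soft_set U P G" "f \<in> PFV \<rightarrow> PFV \<rightarrow> PFV"
  shows "phi_soft_set U P (extended_op f U F G)"
proof -
  have "\<forall>p \<in> PFV. \<forall>q \<in> PFV. f p q \<in> PFV"
    using assms(3) by blast
  with assms(1,2) show ?thesis
    by (auto simp: phi_soft_set_def extended_op_def pythagorean_fuzzy_sets_def PiE_iff)
qed

lemma restricted_op_phi_soft_set:
  assumes "phi_soft_set U P F" "phi_soft_set U P G" "f \<in> PFV \<rightarrow> PFV \<rightarrow> PFV"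
    and "params F \<inter> params G \<noteq> {}"
  shows "phi_soft_set U P (restricted_op f U F G)"
proof -
  have "\<forall>p \<in> PFV. \<forall>q \<in> PFV. f p q \<in> PFV"
    using assms(3) by blast
  with assms(1,2,4) show ?thesis
    by (auto simp: phi_soft_set_def restricted_op_def pythagorean_fuzzy_sets_def PiE_iff)
qed

lemma relative_null_phi_soft_set: "X \<subseteq> P \<Longrightarrow> phi_soft_set U P (relative_null U X)"
  by (auto simp: phi_soft_set_def relative_null_def pythagorean_fuzzy_sets_def PiE_iff PFV_def)

lemma relative_whole_phi_soft_set: "X \<subseteq> P \<Longrightarrow> phi_soft_set U P (relative_whole U X)"
  by (auto simp: phi_soft_set_def relative_whole_def pythagorean_fuzzy_sets_def PiE_iff PFV_def)

end

theory Submission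
  imports Defs
begin

text \<open>
  Both arguments of every operation in the theorem have the same nonempty parameter set \<open>X\<close>. The
  two cases of the extended operation that copy one argument are then empty, so that extended and
  restricted operations agree (\<open>extended_op_eq_restricted_op\<close>) and only the restricted ones have to
  be computed. Those act on each value separately. Since the values outside the prescribed domains
  are fixed by extensionality, every equality reduces to an identity between Pythagorean fuzzy
  values (\<open>restricted_op_eqI\<close>). These identities are the laws of a bounded lattice: join and meet
  are idempotent, \<open>(0, 1)\<close> is the least and \<open>(1, 0)\<close> the greatest value.
\<close>

lemma pfv_join_idem: "pfv_join p p = p"
  by (cases p) simp

lemma pfv_meet_idem: "pfv_meet p p = p"
  by (cases p) simp

text \<open>
  The order behind join and meet is the usual one on membership degrees and the reverse one on
  nonmembership degrees. As all degrees lie in \<open>[0, 1]\<close>, its extreme values are \<open>(0, 1)\<close> and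
  \<open>(1, 0)\<close>.
\<close>

lemma pfv_join_bot: "p \<in> PFV \<Longrightarrow> pfv_join p (0, 1) = p"
  by (cases p) (simp add: PFV_iff)

lemma pfv_meet_bot: "p \<in> PFV \<Longrightarrow> pfv_meet p (0, 1) = (0, 1)"
  by (cases p) (simp add: PFV_iff)

lemma pfv_join_top: "p \<in> PFV \<Longrightarrow> pfv_join p (1, 0) = (1, 0)"
  by (cases p) (simp add: PFV_iff)

lemma pfv_meet_top: "p \<in> PFV \<Longrightarrow> pfv_meet p (1, 0) = p"
  by (cases p) (simp add: PFV_iff)

lemma phi_soft_set_approx_in_PFV:
  "phi_soft_set U P F \<Longrightarrow> x \<in> params F \<Longrightarrow> a \<in> U \<Longrightarrow> approx F x a \<in> PFV"
  by (auto simp: phi_soft_set_def pythagorean_fuzzy_sets_def PiE_iff)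

lemma phi_soft_set_grade_in_PFV:
  "phi_soft_set U P F \<Longrightarrow> x \<in> params F \<Longrightarrow> grade F x \<in> PFV"
  by (auto simp: phi_soft_set_def PiE_iff)

lemma extended_op_eq_restricted_op:
  assumes "params F = params G" and "params G \<noteq> {}"
  shows "extended_op f U F G = restricted_op f U F G"
  using assms by (simp add: extended_op_def restricted_op_def)

text \<open>
  The result of a restricted operation is extensional by construction and \<open>H\<close> is so because it is
  a \<open>\<Phi>\<close>-soft set; hence comparing values at parameters and elements of the universe is enough.
\<close>

lemma restricted_op_eqI:
  assumes H: "phi_soft_set U P H"
    and params: "params F = params H" "params G = params H" "params H \<noteq> {}"
    and approx: "\<And>x a. x \<in> params H \<Longrightarrow> a \<in> U \<Longrightarrow> f (approx F x a) (approx G x a) = approx H x a"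
    and grade: "\<And>x. x \<in> params H \<Longrightarrow> f (grade F x) (grade G x) = grade H x"
  shows "restricted_op f U F G = H"
proof -
  have "(\<lambda>x \<in> params H. \<lambda>a \<in> U. f (approx F x a) (approx G x a)) = approx H"
  proof (rule extensionalityI[of _ "params H"])
    show "approx H \<in> extensional (params H)"
      using H by (simp add: phi_soft_set_def PiE_iff)
    fix x assume x: "x \<in> params H"
    then have "approx H x \<in> extensional U"
      using H by (auto simp: phi_soft_set_def pythagorean_fuzzy_sets_def PiE_iff)
    then have "(\<lambda>a \<in> U. f (approx F x a) (approx G x a)) = approx H x"
      using approx[OF x] by (intro extensionalityI[of _ U]) simp_all
    with x show "(\<lambda>x \<in> params H. \<lambda>a \<in> U. f (approx F x a) (approx G x a)) x = approx H x"
      by simp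
  qed simp
  moreover have "(\<lambda>x \<in> params H. f (grade F x) (grade G x)) = grade H"
    using H grade by (intro extensionalityI[of _ "params H"]) (simp_all add: phi_soft_set_def PiE_iff)
  ultimately show ?thesis
    using params by (simp add: restricted_op_def)
qed

theorem proposition4p7:
  fixes U :: "'u set" and P X :: "'p set" and F :: "('p, 'u) phi_soft"
  assumes "X \<subseteq> P" and "X \<noteq> {}"
    and "phi_soft_set U P F" and "params F = X"
  shows
    "(extended_union U F F = restricted_union U F F \<and>
      restricted_union U F F = F) \<and>
    (extended_inter U F F = restricted_inter U F F \<and>
      restricted_inter U F F = F) \<and>
    (extended_union U F (relative_null U X) = restricted_union U F (relative_null U X) \<and>
      restricted_union U F (relative_null U X) = F) \<and>
    (extended_inter U F (relative_null U X) = restricted_inter U F (relative_null U X) \<and>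
      restricted_inter U F (relative_null U X) = relative_null U X) \<and>
    (extended_union U F (relative_whole U X) = restricted_union U F (relative_whole U X) \<and>
      restricted_union U F (relative_whole U X) = relative_whole U X) \<and>
    (extended_inter U F (relative_whole U X) = restricted_inter U F (relative_whole U X) \<and>
      restricted_inter U F (relative_whole U X) = F)"
proof -
  let ?N = "relative_null U X" and ?W = "relative_whole U X"
  have params: "params F = X" "params ?N = X" "params ?W = X"
    using assms(4) by (simp_all add: relative_null_def relative_whole_def)
  have soft: "phi_soft_set U P F" "phi_soft_set U P ?N" "phi_soft_set U P ?W"
    using assms(1,3) by (simp_all add: relative_null_phi_soft_set relative_whole_phi_soft_set)
  have extended: "extended_op f U F G = restricted_op f U F G" if "params G = X" for f G
    using that params(1) assms(2) by (simp add: extended_op_eq_restricted_op)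
  have F_in: "\<And>x a. x \<in> X \<Longrightarrow> a \<in> U \<Longrightarrow> approx F x a \<in> PFV" "\<And>x. x \<in> X \<Longrightarrow> grade F x \<in> PFV"
    using phi_soft_set_approx_in_PFV[OF assms(3)] phi_soft_set_grade_in_PFV[OF assms(3)] params(1)
    by simp_all
  have N: "\<And>x a. x \<in> X \<Longrightarrow> a \<in> U \<Longrightarrow> approx ?N x a = (0, 1)" "\<And>x. x \<in> X \<Longrightarrow> grade ?N x = (0, 1)"
    by (simp_all add: relative_null_def)
  have W: "\<And>x a. x \<in> X \<Longrightarrow> a \<in> U \<Longrightarrow> approx ?W x a = (1, 0)" "\<And>x. x \<in> X \<Longrightarrow> grade ?W x = (1, 0)"
    by (simp_all add: relative_whole_def)
  have "restricted_op pfv_join U F F = F"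
    using params assms(2)
    by (intro restricted_op_eqI[OF soft(1)]) (simp_all add: pfv_join_idem)
  moreover have "restricted_op pfv_meet U F F = F"
    using params assms(2)
    by (intro restricted_op_eqI[OF soft(1)]) (simp_all add: pfv_meet_idem)
  moreover have "restricted_op pfv_join U F ?N = F"
    using params assms(2) F_in N
    by (intro restricted_op_eqI[OF soft(1)]) (simp_all add: pfv_join_bot)
  moreover have "restricted_op pfv_meet U F ?W = F"
    using params assms(2) F_in W
    by (intro restricted_op_eqI[OF soft(1)]) (simp_all add: pfv_meet_top)
  moreover have "restricted_op pfv_meet U F ?N = ?N"
    using params assms(2) F_in N
    by (intro restricted_op_eqI[OF soft(2)]) (simp_all add: pfv_meet_bot)
  moreover have "restricted_op pfv_join U F ?W = ?W"
    using params assms(2) F_in W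
    by (intro restricted_op_eqI[OF soft(3)]) (simp_all add: pfv_join_top)
  ultimately show ?thesis
    using params
    by (simp add: extended_union_def extended_inter_def restricted_union_def restricted_inter_def
        extended)
qed

end
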